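(* For every complex number $\alpha$, as formal power series in $x$, $$\sum_{n\ge1}x^n\sum_{\lambda\vdash n}\sum_{v\in\lambda}h_v^{\alpha}=\prod_{m\ge1}\frac1{1-x^m}\times\sum_{k\ge1}\frac{x^kk^{\alpha+1}}{1-x^k}.$$
   Context: $\lambda\vdash n$ means $\lambda$ is a partition of $n$ (weakly decreasing positive integers $\lambda_1\ge\cdots\ge\lambda_\ell$ summing to $n$). The boxes of $\lambda$ are the pairs $(i,j)$ with $1\le j\le \lambda_i$; the hook length of $v=(i,j)$ is $h_v=\lambda_i-j+\lambda'_j-i+1$ with $\lambda'_j=\#\{k:\lambda_k\ge j\}$. *)

theory Defs
  imports "HOL-Analysis.Analysis" "HOL-Computational_Algebra.Formal_Power_Series"
begin

definition partitions_of :: "nat \<Rightarrow> nat list set" where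
  "partitions_of n = {l. sorted_wrt (\<ge>) l \<and> (\<forall>a\<in>set l. 0 < a) \<and> sum_list l = n}"

text \<open>Rows and columns are numbered from 1, so \<open>part l i\<close> is only meaningful for
  \<open>1 \<le> i \<le> length l\<close>.\<close>

definition part :: "nat list \<Rightarrow> nat \<Rightarrow> nat" where
  "part l i = l ! (i - 1)"

definition conj_part :: "nat list \<Rightarrow> nat \<Rightarrow> nat" where
  "conj_part l j = card {k \<in> {1..length l}. part l k \<ge> j}"

definition boxes :: "nat list \<Rightarrow> (nat \<times> nat) set" where
  "boxes l = {(i, j). i \<in> {1..length l} \<and> j \<in> {1..part l i}}"

text \<open>For a box \<open>(i, j)\<close> of a partition one has \<open>j \<le> part l i\<close> and \<open>i \<le> conj_part l j\<close>,
  so the subtractions on natural numbers below are never truncated.\<close>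

definition hook_length :: "nat list \<Rightarrow> nat \<times> nat \<Rightarrow> nat" where
  "hook_length l = (\<lambda>(i, j). part l i - j + conj_part l j - i + 1)"

lemma box_le_conj_part:
  assumes "l \<in> partitions_of n" "(i, j) \<in> boxes l"
  shows "j \<le> part l i" "i \<le> conj_part l j"
proof -
  show j: "j \<le> part l i" using assms(2) by (simp add: boxes_def)
  have i: "1 \<le> i" "i \<le> length l" using assms(2) by (auto simp: boxes_def)
  have s: "sorted_wrt (\<ge>) l" using assms(1) by (simp add: partitions_of_def)
  have "part l i \<le> part l k" if "k \<in> {1..i}" for k
  proof (cases "k = i")
    case False
    then have "k - 1 < i - 1" "i - 1 < length l" using that i by auto
    then show ?thesis using sorted_wrt_nth_less[OF s] by (simp add: part_def)
  qed simp
  then have "{1..i} \<subseteq> {k \<in> {1..length l}. part l k \<ge> j}"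
    using i j by fastforce
  then have "card {1..i} \<le> conj_part l j"
    unfolding conj_part_def by (intro card_mono) auto
  then show "i \<le> conj_part l j" by simp
qed

lemma finite_boxes: "finite (boxes l)"
proof -
  have "boxes l = (SIGMA i:{1..length l}. {1..part l i})" by (auto simp: boxes_def)
  then show ?thesis by simp
qed

lemma finite_partitions_of: "finite (partitions_of n)"
proof (rule finite_subset)
  have "length l \<le> sum_list l" if "\<forall>a\<in>set l. 0 < a" for l :: "nat list"
    using that by (induction l) auto
  then show "partitions_of n \<subseteq> {l. set l \<subseteq> {..n} \<and> length l \<le> n}"
    by (auto simp: partitions_of_def intro: member_le_sum_list)
  show "finite {l. set l \<subseteq> {..n} \<and> length l \<le> n}"
    by (rule finite_lists_length_le) simp
qed

definition hook_power_sum :: "complex \<Rightarrow> nat \<Rightarrow> complex" where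
  "hook_power_sum \<alpha> n =
     (\<Sum>l\<in>partitions_of n. \<Sum>v\<in>boxes l. of_nat (hook_length l v) powr \<alpha>)"

text \<open>Infinite sums and products of formal power series are taken with respect to the metric
  on \<^typ>\<open>complex fps\<close> from the library, whose topology is the \<open>fps_X\<close>-adic one.\<close>

end

(* A partition l with at most m rows is encoded by its beta set, the m numbers l_i + m - i.
   Hooks of length k in l correspond to the elements b >= k of the beta set with b - k missing;
   replacing b by b - k removes the corresponding rim hook. Once m is large, every beta set admits
   exactly k more ways to add a rim hook of length k than to remove one. Double counting the pairs
   (partition, removable rim hook) gives N_k(n + k) = N_k(n) + k p(n) for the number N_k(n) of
   hooks of length k in all partitions of n, so the generating function of N_k is k x^k / (1 - x^k)
   times that of p. The theorem is the sum of these identities weighted by k^alpha. *)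

theory Submission
  imports Defs
begin

section \<open>Partitions and their beta sets\<close>

definition is_partition :: "nat list \<Rightarrow> bool" where
  "is_partition l \<longleftrightarrow> sorted_wrt (\<ge>) l \<and> (\<forall>a\<in>set l. 0 < a)"

text \<open>Rows are numbered from 0 here, unlike in \<open>part\<close>, and rows past the end of
  \<open>l\<close> count as empty, so that a shorter partition also gets m beta numbers.\<close>

definition beta_nth :: "nat \<Rightarrow> nat list \<Rightarrow> nat \<Rightarrow> nat" where
  "beta_nth m l i = (if i < length l then l ! i else 0) + (m - 1 - i)"

definition beta_set :: "nat \<Rightarrow> nat list \<Rightarrow> nat set" where
  "beta_set m l = beta_nth m l ` {..<m}"

text \<open>The candidates for beta sets of partitions of n. The offset \<open>\<Sum>{..<m}\<close>
  is the sum of the beta set of the empty partition.\<close>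

definition beta_sets :: "nat \<Rightarrow> nat \<Rightarrow> nat set set" where
  "beta_sets m n = {B. finite B \<and> card B = m \<and> \<Sum>B = n + \<Sum>{..<m}}"

definition hook_ends :: "nat \<Rightarrow> nat set \<Rightarrow> nat set" where
  "hook_ends k B = {b \<in> B. k \<le> b \<and> b - k \<notin> B}"

text \<open>The counterpart of \<open>hook_ends\<close>: raising such an element by k adds a rim
  hook of length k.\<close>

definition hook_starts :: "nat \<Rightarrow> nat set \<Rightarrow> nat set" where
  "hook_starts k B = {b \<in> B. b + k \<notin> B}"

definition hook_count :: "nat \<Rightarrow> nat \<Rightarrow> nat" where
  "hook_count k n = (\<Sum>l\<in>partitions_of n. card {v \<in> boxes l. hook_length l v = k})"

lemma partitions_of_iff: "l \<in> partitions_of n \<longleftrightarrow> is_partition l \<and> sum_list l = n"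
  by (auto simp: partitions_of_def is_partition_def)

lemma is_partition_Cons:
  "is_partition (a # l) \<longleftrightarrow> 0 < a \<and> (\<forall>x\<in>set l. x \<le> a) \<and> is_partition l"
  by (auto simp: is_partition_def)

lemma length_le_sum_list: "is_partition l \<Longrightarrow> length l \<le> sum_list l"
  by (induction l) (auto simp: is_partition_Cons)

lemma finite_beta_set [simp]: "finite (beta_set m l)"
  by (simp add: beta_set_def)

lemma beta_set_Nil: "beta_set m [] = {..<m}"
proof -
  have "x \<in> (\<lambda>i. m - Suc i) ` {..<m}" if "x < m" for x
    using that by (intro image_eqI[of _ _ "m - Suc x"]) auto
  then show ?thesis by (auto simp: beta_set_def beta_nth_def)
qed

text \<open>A new first row pushes every old row down by one, and raising m by one compensates for
  this. All inductions over the rows rest on this step.\<close>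

lemma beta_set_Cons: "beta_set (Suc m) (a # l) = insert (a + m) (beta_set m l)"
proof -
  have "beta_nth (Suc m) (a # l) (Suc i) = beta_nth m l i" for i
    by (auto simp: beta_nth_def)
  then show ?thesis
    by (simp add: beta_set_def lessThan_Suc_eq_insert_0 image_image) (simp add: beta_nth_def)
qed

text \<open>Guarantees that the element inserted in \<open>beta_set_Cons\<close> is new and is the
  largest.\<close>

lemma beta_set_less:
  assumes "length l \<le> m" "\<forall>y\<in>set l. y \<le> a" "x \<in> beta_set m l"
  shows "x < a + m"
proof -
  obtain i where i: "i < m" "x = beta_nth m l i" using assms(3) by (auto simp: beta_set_def)
  have "i < length l \<Longrightarrow> l ! i \<le> a" using assms(2) by auto
  then show ?thesis using i by (auto simp: beta_nth_def)
qed

lemma card_sum_beta_set: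
  assumes "is_partition l" "length l \<le> m"
  shows "card (beta_set m l) = m \<and> \<Sum>(beta_set m l) = sum_list l + \<Sum>{..<m}"
  using assms
proof (induction l arbitrary: m)
  case Nil
  then show ?case by (simp add: beta_set_Nil)
next
  case (Cons a l)
  then obtain m' where m: "m = Suc m'" by (cases m) auto
  have "a + m' \<notin> beta_set m' l"
    using beta_set_less[of l m' a "a + m'"] Cons.prems m by (auto simp: is_partition_Cons)
  then show ?case
    using Cons.IH[of m'] Cons.prems m by (auto simp: beta_set_Cons is_partition_Cons)
qed

lemma Max_beta_set:
  assumes "is_partition (a # l)" "length l \<le> m"
  shows "Max (beta_set (Suc m) (a # l)) = a + m"
  using assms beta_set_less[of l m a]
  by (intro Max_eqI) (auto simp: beta_set_Cons is_partition_Cons intro: less_imp_le)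

text \<open>The maximum of the beta set determines the first row; removing it leaves the beta set of
  the remaining rows. A nonempty partition cannot share its beta set with the empty one, as its
  maximum exceeds m - 1.\<close>

lemma beta_set_inject:
  assumes "is_partition l" "length l \<le> m" "is_partition l'" "length l' \<le> m"
    and "beta_set m l = beta_set m l'"
  shows "l = l'"
  using assms
proof (induction l arbitrary: l' m)
  case Nil
  show ?case
  proof (cases l')
    case (Cons a r)
    then obtain m' where m: "m = Suc m'" using Nil by (cases m) auto
    have "a + m' \<in> beta_set m l'" by (simp add: Cons m beta_set_Cons)
    also have "\<dots> = {..<Suc m'}" using Nil m by (simp add: beta_set_Nil)
    finally show ?thesis using Nil.prems(3) Cons by (simp add: is_partition_Cons)
  qed simp
next
  case (Cons a l)
  then obtain m' where m: "m = Suc m'" by (cases m) auto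
  show ?case
  proof (cases l')
    case Nil
    have "a + m' \<in> beta_set m (a # l)" by (simp add: m beta_set_Cons)
    also have "\<dots> = {..<Suc m'}" using Cons.prems(5) Nil m by (simp add: beta_set_Nil)
    finally show ?thesis using Cons.prems(1) by (simp add: is_partition_Cons)
  next
    case (Cons b r)
    note c = this
    have ab: "a = b"
      using Max_beta_set[of a l m'] Max_beta_set[of b r m'] Cons.prems c m by simp
    have "a + m' \<notin> beta_set m' l" "a + m' \<notin> beta_set m' r"
      using beta_set_less[of l m' a "a + m'"] beta_set_less[of r m' a "a + m'"] Cons.prems c m ab
      by (auto simp: is_partition_Cons)
    then have "beta_set m' l = beta_set m' r"
      using Cons.prems(5) c m ab by (simp add: beta_set_Cons insert_ident)
    then show ?thesis
      using Cons.IH[of m' r] Cons.prems c m ab by (auto simp: is_partition_Cons)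
  qed
qed

text \<open>The rows are read off from the largest element downwards: the maximum b of a set of m +
  1 numbers stands for a first row of length b - m.\<close>

lemma beta_set_surj:
  assumes "finite B" "card B = m"
  shows "\<exists>l. is_partition l \<and> length l \<le> m \<and> beta_set m l = B"
  using assms
proof (induction m arbitrary: B)
  case 0
  then show ?case by (intro exI[of _ "[]"]) (auto simp: is_partition_def beta_set_Nil)
next
  case (Suc m)
  define b where "b = Max B"
  have bB: "b \<in> B" unfolding b_def using Suc.prems by (intro Max_in) auto
  have le: "x \<le> b" if "x \<in> B" for x unfolding b_def using that Suc.prems by simp
  have sub: "B \<subseteq> {..b}" using le by auto
  have mb: "m \<le> b" using card_mono[OF _ sub] Suc.prems by simp
  obtain l where l: "is_partition l" "length l \<le> m" "beta_set m l = B - {b}"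
    using Suc.IH[of "B - {b}"] Suc.prems bB by auto
  show ?case
  proof (cases "b = m")
    case True
    \<comment> \<open>A first row of length 0 is not allowed in the list. Here B consists of m + 1
      numbers up to m, so it is the whole interval and belongs to the empty partition.\<close>
    have "B = {..b}" using True Suc.prems by (intro card_subset_eq sub) auto
    then show ?thesis using True
      by (intro exI[of _ "[]"]) (auto simp: is_partition_def beta_set_Nil)
  next
    case False
    \<comment> \<open>The new row must dominate the old ones. It suffices to look at the first old
      row c, whose beta number c + m - 1 lies in B below b.\<close>
    have "y \<le> b - m" if y: "y \<in> set l" for y
    proof -
      obtain c r where cr: "l = c # r" using y by (cases l) auto
      then obtain m' where m': "m = Suc m'" using l by (cases m) auto
      have "c + m' \<in> B - {b}" using l(3) cr m' by (auto simp: beta_set_Cons)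
      then have "c + m' < b" using le[of "c + m'"] by auto
      then show ?thesis using y cr l m' by (auto simp: is_partition_Cons)
    qed
    then have "is_partition ((b - m) # l)" using l False mb by (auto simp: is_partition_Cons)
    moreover have "beta_set (Suc m) ((b - m) # l) = B"
      using l mb bB by (auto simp: beta_set_Cons)
    ultimately show ?thesis using l by (intro exI[of _ "(b - m) # l"]) auto
  qed
qed

text \<open>A partition of n has at most n rows, so n \<le> m leaves room for all of them.\<close>

lemma bij_betw_beta_set:
  assumes "n \<le> m"
  shows "bij_betw (beta_set m) (partitions_of n) (beta_sets m n)"
proof (rule bij_betw_imageI)
  have len: "length l \<le> m" if "l \<in> partitions_of n" for l
    using that length_le_sum_list[of l] assms by (auto simp: partitions_of_iff)
  show "inj_on (beta_set m) (partitions_of n)"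
    by (intro inj_onI) (metis beta_set_inject len partitions_of_iff)
  show "beta_set m ` partitions_of n = beta_sets m n"
  proof
    show "beta_set m ` partitions_of n \<subseteq> beta_sets m n"
      using card_sum_beta_set len by (auto simp: beta_sets_def partitions_of_iff)
    show "beta_sets m n \<subseteq> beta_set m ` partitions_of n"
    proof
      fix B assume B: "B \<in> beta_sets m n"
      then obtain l where l: "is_partition l" "length l \<le> m" "beta_set m l = B"
        using beta_set_surj[of B m] by (auto simp: beta_sets_def)
      then have "sum_list l = n" using card_sum_beta_set[of l m] B by (auto simp: beta_sets_def)
      then show "B \<in> beta_set m ` partitions_of n" using l by (auto simp: partitions_of_iff)
    qed
  qed
qed

text \<open>B is the beta set of some partition, and the excess of its sum is the size of that
  partition.\<close>

lemma sum_ge_sum_lessThan_card: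
  fixes B :: "nat set"
  assumes "finite B"
  shows "\<Sum>{..<card B} \<le> \<Sum>B"
  using beta_set_surj[OF assms refl] card_sum_beta_set by fastforce

section \<open>Hooks as pairs of a beta number and a smaller gap\<close>

lemma part_ge_iff:
  assumes "is_partition l" "i \<in> {1..length l}" "1 \<le> j"
  shows "j \<le> part l i \<longleftrightarrow> i \<le> conj_part l j"
proof
  assume "j \<le> part l i"
  then show "i \<le> conj_part l j"
    using box_le_conj_part(2)[of l "sum_list l" i j] assms
    by (auto simp: partitions_of_iff boxes_def)
next
  assume *: "i \<le> conj_part l j"
  show "j \<le> part l i"
  proof (rule ccontr)
    assume n: "\<not> j \<le> part l i"
    \<comment> \<open>Rows weakly decrease, so if row i is shorter than j, the rows of length at
      least j all lie strictly above it.\<close>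
    have "k < i" if k: "k \<in> {1..length l}" "j \<le> part l k" for k
    proof (rule ccontr)
      assume "\<not> k < i"
      then have "i < k" using k n by (cases "i = k") auto
      then have "part l k \<le> part l i"
        using sorted_wrt_nth_less[of "(\<ge>)" l "i - 1" "k - 1"] k assms
        by (auto simp: is_partition_def part_def)
      then show False using k n by simp
    qed
    then have "{k \<in> {1..length l}. part l k \<ge> j} \<subseteq> {1..<i}" by auto
    then have "conj_part l j \<le> card {1..<i}"
      unfolding conj_part_def by (intro card_mono) auto
    then show False using * assms by auto
  qed
qed

lemma conj_part_le_length: "conj_part l j \<le> length l"
proof -
  have "conj_part l j \<le> card {1..length l}"
    unfolding conj_part_def by (intro card_mono) auto
  then show ?thesis by simp
qed

lemma conj_part_antimono: "j \<le> j' \<Longrightarrow> conj_part l j' \<le> conj_part l j"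
  unfolding conj_part_def by (intro card_mono) auto

lemma beta_nth_strict_antimono:
  assumes "is_partition l" "length l \<le> m" "i < i'" "i' < m"
  shows "beta_nth m l i' < beta_nth m l i"
proof -
  have "i' < length l \<Longrightarrow> l ! i' \<le> l ! i"
    using assms sorted_wrt_nth_less[of "(\<ge>)" l i i'] by (auto simp: is_partition_def)
  then show ?thesis using assms by (auto simp: beta_nth_def)
qed

text \<open>The gap of the beta set that belongs to column \<open>j\<close>.\<close>

definition beta_gap :: "nat \<Rightarrow> nat list \<Rightarrow> nat \<Rightarrow> nat" where
  "beta_gap m l j = m + j - 1 - conj_part l j"

text \<open>The column gaps are distinct, miss the beta set and lie below the beta number of row i,
  so only a count remains. That beta number is \<open>part l i + m - i\<close>; below it lie exactly
  the m - i beta numbers of the later rows, which leaves \<open>part l i\<close> gaps.\<close>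

lemma bij_betw_beta_gap:
  assumes l: "is_partition l" "length l \<le> m" and i: "i \<in> {1..length l}"
  shows "bij_betw (beta_gap m l) {1..part l i} ({..<beta_nth m l (i - 1)} - beta_set m l)"
proof -
  let ?B = "beta_set m l" and ?b = "beta_nth m l (i - 1)"
  have b: "beta_nth m l (r - 1) = part l r + m - r" if "r \<in> {1..length l}" for r
    using that l by (auto simp: beta_nth_def part_def)
  have gap: "beta_gap m l j + conj_part l j + 1 = m + j" if "1 \<le> j" for j
    using that l conj_part_le_length[of l j] by (auto simp: beta_gap_def)
  have inj: "inj_on (beta_gap m l) {1..part l i}"
  proof (rule linorder_inj_onI')
    fix j j' assume j: "j \<in> {1..part l i}" "j' \<in> {1..part l i}" "j < j'"
    then show "beta_gap m l j \<noteq> beta_gap m l j'"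
      using gap[of j] gap[of j'] conj_part_antimono[of j j' l] by auto
  qed
  have notin: "beta_gap m l j \<notin> ?B" if j: "1 \<le> j" for j
  proof
    assume "beta_gap m l j \<in> ?B"
    then obtain r where r: "r < m" "beta_gap m l j = beta_nth m l r"
      by (auto simp: beta_set_def)
    show False
    proof (cases "r < length l")
      \<comment> \<open>Equality would mean that \<open>part l (Suc r) - j\<close> and
        \<open>r - conj_part l j\<close> agree as integers. By \<open>part_ge_iff\<close> exactly
        one of them is negative.\<close>
      case True
      then show False
        using part_ge_iff[of l "Suc r" j] b[of "Suc r"] r gap[of j] l j
        by (cases "j \<le> part l (Suc r)") auto
    next
      \<comment> \<open>The beta number m - 1 - r of an empty row is too small, because
        \<open>conj_part l j\<close> is at most r.\<close>
      case False
      then show False using r gap[of j] conj_part_le_length[of l j] j by (auto simp: beta_nth_def)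
    qed
  qed
  have lt: "beta_gap m l j < ?b" if j: "j \<in> {1..part l i}" for j
    using part_ge_iff[of l i j] b[of i] gap[of j] l i j by auto
  have sub: "beta_gap m l ` {1..part l i} \<subseteq> {..<?b} - ?B"
    using notin lt by auto
  have "?B \<inter> {..<?b} = beta_nth m l ` {i..<m}"
  proof (intro equalityI subsetI)
    fix x assume "x \<in> ?B \<inter> {..<?b}"
    then obtain r where r: "r < m" "x = beta_nth m l r" "x < ?b" by (auto simp: beta_set_def)
    have "i \<le> r"
    proof (rule ccontr)
      assume "\<not> i \<le> r"
      then have "r = i - 1 \<or> r < i - 1" by auto
      moreover have "i - 1 < m" using i l by auto
      ultimately show False using beta_nth_strict_antimono[OF l, of r "i - 1"] r by auto
    qed
    then show "x \<in> beta_nth m l ` {i..<m}" using r by auto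
  next
    fix x assume "x \<in> beta_nth m l ` {i..<m}"
    then show "x \<in> ?B \<inter> {..<?b}"
      using beta_nth_strict_antimono[OF l, of "i - 1"] i by (force simp: beta_set_def)
  qed
  moreover have "inj_on (beta_nth m l) {i..<m}"
    using beta_nth_strict_antimono[OF l] by (intro linorder_inj_onI') force
  ultimately have "card (?B \<inter> {..<?b}) = m - i" by (simp add: card_image)
  then have "card ({..<?b} - ?B) = ?b - (m - i)"
    by (subst card_Diff_subset_Int) (auto simp: Int_commute)
  also have "\<dots> = part l i" using b[of i] i l by auto
  finally have "card (beta_gap m l ` {1..part l i}) = card ({..<?b} - ?B)"
    using inj by (simp add: card_image)
  then show ?thesis
    using inj sub by (intro bij_betw_imageI card_subset_eq) auto
qed

text \<open>The hook length of (i, j) is the beta number of row i minus the gap of column j. Hence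
  the hooks of length k in row i correspond to a gap exactly k below its beta number, and sending a
  box to the beta number of its row loses nothing once k is fixed.\<close>

lemma card_hook_length_eq:
  assumes l: "is_partition l" "length l \<le> m" and k: "1 \<le> k"
  shows "card {v \<in> boxes l. hook_length l v = k} = card (hook_ends k (beta_set m l))"
proof -
  let ?B = "beta_set m l" and ?b = "\<lambda>i. beta_nth m l (i - 1)" and ?c = "beta_gap m l"
  have inj: "inj_on ?b {1..m}"
  proof (rule linorder_inj_onI')
    fix i i' assume "i \<in> {1..m}" "i' \<in> {1..m}" "i < i'"
    then have "i - 1 < i' - 1" "i' - 1 < m" by auto
    then show "?b i \<noteq> ?b i'" using beta_nth_strict_antimono[OF l, of "i - 1" "i' - 1"] by auto
  qed
  have hook: "?b i = ?c j + hook_length l (i, j)" if "(i, j) \<in> boxes l" for i j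
  proof -
    have "j \<le> part l i" "i \<le> conj_part l j"
      using that box_le_conj_part[of l "sum_list l"] l by (auto simp: partitions_of_iff)
    moreover have "?b i = part l i + m - i"
      using that l by (auto simp: beta_nth_def part_def boxes_def)
    ultimately show ?thesis
      using that l conj_part_le_length[of l j]
      by (auto simp: hook_length_def beta_gap_def boxes_def)
  qed
  have "bij_betw (\<lambda>(i, j). ?b i) {v \<in> boxes l. hook_length l v = k} (hook_ends k ?B)"
  proof (rule bij_betw_imageI)
    show "inj_on (\<lambda>(i, j). ?b i) {v \<in> boxes l. hook_length l v = k}"
    proof (rule inj_onI, clarify)
      fix i j i' j'
      assume v: "(i, j) \<in> boxes l" "(i', j') \<in> boxes l"
        and h: "k = hook_length l (i, j)" "hook_length l (i', j') = hook_length l (i, j)"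
        and e: "?b i = ?b i'"
      have ii: "i = i'"
        using inj_onD[OF inj e] v l by (auto simp: boxes_def)
      have "?c j = ?c j'" using hook[OF v(1)] hook[OF v(2)] h e by simp
      then have "j = j'"
        using bij_betw_beta_gap[OF l, of i] v ii
        by (auto simp: boxes_def bij_betw_def dest: inj_onD)
      then show "i = i' \<and> j = j'" using ii by simp
    qed
    show "(\<lambda>(i, j). ?b i) ` {v \<in> boxes l. hook_length l v = k} = hook_ends k ?B"
    proof (intro equalityI subsetI)
      fix b assume "b \<in> (\<lambda>(i, j). ?b i) ` {v \<in> boxes l. hook_length l v = k}"
      then obtain i j where v: "(i, j) \<in> boxes l" "hook_length l (i, j) = k" "b = ?b i" by auto
      have "?c j \<in> {..<?b i} - ?B"
        using bij_betw_beta_gap[OF l, of i] v by (auto simp: boxes_def bij_betw_def)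
      moreover have "b \<in> ?B" using v l by (auto simp: beta_set_def boxes_def)
      ultimately show "b \<in> hook_ends k ?B"
        using hook[OF v(1)] v by (auto simp: hook_ends_def)
    next
      fix b assume b: "b \<in> hook_ends k ?B"
      then obtain i where i: "i \<in> {1..m}" "b = ?b i"
        by (force simp: hook_ends_def beta_set_def intro: that[of "Suc _"])
      \<comment> \<open>The beta number of an empty row has no gap below it: all smaller numbers
        belong to later empty rows.\<close>
      have il: "i \<in> {1..length l}"
      proof (rule ccontr)
        assume "i \<notin> {1..length l}"
        then have "length l \<le> i - 1" "1 \<le> i" using i by auto
        then have "b = m - i" "k \<le> b" "1 \<le> i" "length l \<le> i - 1"
          using i b by (auto simp: beta_nth_def hook_ends_def)
        then have "b - k = beta_nth m l (i - 1 + k)" "i - 1 + k < m"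
          using i k by (auto simp: beta_nth_def)
        then show False using b by (auto simp: hook_ends_def beta_set_def)
      qed
      have "b - k \<in> {..<?b i} - ?B" using b i k by (auto simp: hook_ends_def)
      also have "\<dots> = ?c ` {1..part l i}"
        using bij_betw_beta_gap[OF l il] by (simp add: bij_betw_def)
      finally obtain j where j: "j \<in> {1..part l i}" "b - k = ?c j" by blast
      have v: "(i, j) \<in> boxes l" using il j by (auto simp: boxes_def)
      have "hook_length l (i, j) = k" using hook[OF v] i j b by (auto simp: hook_ends_def)
      then show "b \<in> (\<lambda>(i, j). ?b i) ` {v \<in> boxes l. hook_length l v = k}"
        using v i by force
    qed
  qed
  then show ?thesis by (rule bij_betw_same_card)
qed

text \<open>The freedom in m matters: partitions of n and of n + k will be compared through beta
  sets of the same cardinality.\<close>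

lemma hook_count_eq:
  assumes "n \<le> m" "1 \<le> k"
  shows "hook_count k n = (\<Sum>B\<in>beta_sets m n. card (hook_ends k B))"
proof -
  have "hook_count k n = (\<Sum>l\<in>partitions_of n. card (hook_ends k (beta_set m l)))"
    unfolding hook_count_def
  proof (rule sum.cong[OF refl])
    fix l assume "l \<in> partitions_of n"
    then show "card {v \<in> boxes l. hook_length l v = k} = card (hook_ends k (beta_set m l))"
      using length_le_sum_list[of l] assms
      by (intro card_hook_length_eq) (auto simp: partitions_of_iff)
  qed
  also have "\<dots> = (\<Sum>B\<in>beta_sets m n. card (hook_ends k B))"
    using bij_betw_beta_set[OF assms(1)] by (rule sum.reindex_bij_betw)
  finally show ?thesis .
qed

lemma finite_beta_sets: "n \<le> m \<Longrightarrow> finite (beta_sets m n)"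
  using bij_betw_finite[OF bij_betw_beta_set[of n m]] finite_partitions_of by simp

section \<open>Adding and removing rim hooks by moving one element\<close>

lemma sum_card_beta_move:
  fixes B :: "nat set"
  assumes "finite B" "b \<in> B" "c \<notin> B"
  shows "card (insert c (B - {b})) = card B" "\<Sum>(insert c (B - {b})) + b = \<Sum>B + c"
proof -
  have "card (insert c (B - {b})) = Suc (card (B - {b}))"
    using assms by (intro card_insert_disjoint) auto
  then show "card (insert c (B - {b})) = card B" using card.remove[OF assms(1,2)] by simp
  show "\<Sum>(insert c (B - {b})) + b = \<Sum>B + c" using assms by (simp add: sum.remove[of B b])
qed

text \<open>Both sides count pairs of a set and a marked element. Lowering the marked element by k
  turns a hook end into a hook start of the new set, and raising it by k undoes this.\<close>

lemma sum_hook_ends_eq_sum_hook_starts: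
  assumes k: "1 \<le> k" and m: "n + k \<le> m"
  shows "(\<Sum>B\<in>beta_sets m (n + k). card (hook_ends k B))
       = (\<Sum>B\<in>beta_sets m n. card (hook_starts k B))"
proof -
  have fin: "finite (hook_ends k B)" "finite (hook_starts k B)" if "B \<in> beta_sets m n'" for B n'
    using that by (auto simp: hook_ends_def hook_starts_def beta_sets_def)
  let ?R = "SIGMA B:beta_sets m (n + k). hook_ends k B"
  let ?S = "SIGMA B:beta_sets m n. hook_starts k B"
  have "bij_betw (\<lambda>(B, b). (insert (b - k) (B - {b}), b - k)) ?R ?S"
  proof (rule bij_betw_byWitness[where f' = "\<lambda>(B, b). (insert (b + k) (B - {b}), b + k)"])
    show "\<forall>x\<in>?R. (\<lambda>(B, b). (insert (b + k) (B - {b}), b + k))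
        ((\<lambda>(B, b). (insert (b - k) (B - {b}), b - k)) x) = x"
      by (auto simp: hook_ends_def)
    show "\<forall>x\<in>?S. (\<lambda>(B, b). (insert (b - k) (B - {b}), b - k))
        ((\<lambda>(B, b). (insert (b + k) (B - {b}), b + k)) x) = x"
      by (auto simp: hook_starts_def)
    show "(\<lambda>(B, b). (insert (b - k) (B - {b}), b - k)) ` ?R \<subseteq> ?S"
    proof clarify
      fix B b assume B: "B \<in> beta_sets m (n + k)" and b: "b \<in> hook_ends k B"
      then show "insert (b - k) (B - {b}) \<in> beta_sets m n
          \<and> b - k \<in> hook_starts k (insert (b - k) (B - {b}))"
        using sum_card_beta_move[of B b "b - k"] k
        by (auto simp: beta_sets_def hook_ends_def hook_starts_def)
    qed
    show "(\<lambda>(B, b). (insert (b + k) (B - {b}), b + k)) ` ?S \<subseteq> ?R"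
    proof clarify
      fix B b assume B: "B \<in> beta_sets m n" and b: "b \<in> hook_starts k B"
      then show "insert (b + k) (B - {b}) \<in> beta_sets m (n + k)
          \<and> b + k \<in> hook_ends k (insert (b + k) (B - {b}))"
        using sum_card_beta_move[of B b "b + k"] k
        by (auto simp: beta_sets_def hook_ends_def hook_starts_def)
    qed
  qed
  then have "card ?R = card ?S" by (rule bij_betw_same_card)
  then show ?thesis using finite_beta_sets[of n m] finite_beta_sets[of "n + k" m] m fin
    by (simp add: card_SigmaI)
qed

text \<open>Lowering an element by more than n would push the sum below that of 0, ..., m - 1, the
  least possible for m distinct numbers.\<close>

lemma hook_ends_empty:
  assumes "n < k" "B \<in> beta_sets m n"
  shows "hook_ends k B = {}"
proof (rule ccontr)
  assume "hook_ends k B \<noteq> {}"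
  then obtain b where b: "b \<in> B" "k \<le> b" "b - k \<notin> B" by (auto simp: hook_ends_def)
  have B: "finite B" "card B = m" "\<Sum>B = n + \<Sum>{..<m}"
    using assms by (auto simp: beta_sets_def)
  define C where "C = insert (b - k) (B - {b})"
  have "card C = m" "\<Sum>C + b = \<Sum>B + (b - k)"
    unfolding C_def using sum_card_beta_move[of B b "b - k"] b B by auto
  moreover have "\<Sum>{..<card C} \<le> \<Sum>C"
    using B by (intro sum_ge_sum_lessThan_card) (simp add: C_def)
  ultimately show False using B b assms(1) by simp
qed

lemma hook_count_eq_0: "n < k \<Longrightarrow> hook_count k n = 0"
  using hook_count_eq[of n n k] hook_ends_empty by (auto intro: sum.neutral)

text \<open>Let D be the set of b in B with b + k in B. The hook starts are B without D; the hook
  ends are the elements of B that are at least k, without the shift of D by k. As B contains all of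
  0, ..., k - 1, the counts are m - |D| and m - k - |D|.\<close>

lemma card_hook_starts:
  assumes "n + k \<le> m" "B \<in> beta_sets m n"
  shows "card (hook_starts k B) = card (hook_ends k B) + k"
proof -
  obtain l where l: "l \<in> partitions_of n" "B = beta_set m l"
    using bij_betw_beta_set[of n m] assms by (auto simp: bij_betw_def)
  have len: "length l \<le> n" using l length_le_sum_list[of l] by (auto simp: partitions_of_iff)
  have fin: "finite B" and card: "card B = m" using assms by (auto simp: beta_sets_def)
  \<comment> \<open>At most n rows are nonempty, so the last m - n \<ge> k rows are empty, and the
    last k of them have the beta numbers 0, ..., k - 1.\<close>
  have low: "{..<k} \<subseteq> B"
  proof
    fix x assume "x \<in> {..<k}"
    then have "beta_nth m l (m - 1 - x) = x" "m - 1 - x < m"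
      using assms len by (auto simp: beta_nth_def)
    then have "x \<in> beta_nth m l ` {..<m}" by (intro image_eqI[of _ _ "m - 1 - x"]) auto
    then show "x \<in> B" using l by (simp add: beta_set_def)
  qed
  let ?D = "{b \<in> B. b + k \<in> B}"
  have "hook_starts k B = B - ?D" by (auto simp: hook_starts_def)
  then have 1: "card (hook_starts k B) = m - card ?D"
    using fin card by (simp add: card_Diff_subset)
  have "hook_ends k B = (B - {..<k}) - (\<lambda>b. b + k) ` ?D"
  proof (intro equalityI subsetI)
    fix b assume b: "b \<in> (B - {..<k}) - (\<lambda>b. b + k) ` ?D"
    then have "b = b - k + k" "b \<in> B" "b \<notin> (\<lambda>b. b + k) ` ?D" by auto
    then have "b - k \<notin> B" by (metis (mono_tags, lifting) imageI mem_Collect_eq)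
    then show "b \<in> hook_ends k B" using b by (auto simp: hook_ends_def)
  qed (auto simp: hook_ends_def)
  moreover have "(\<lambda>b. b + k) ` ?D \<subseteq> B - {..<k}" by auto
  moreover have "card ((\<lambda>b. b + k) ` ?D) = card ?D" by (intro card_image) auto
  ultimately have 2: "card (hook_ends k B) = m - k - card ?D"
    and 3: "card ?D \<le> m - k"
    using fin card low card_mono[of "B - {..<k}" "(\<lambda>b. b + k) ` ?D"]
    by (auto simp: card_Diff_subset)
  show ?thesis using 1 2 3 assms by simp
qed

lemma hook_count_rec:
  assumes "1 \<le> k"
  shows "hook_count k (n + k) = hook_count k n + k * card (partitions_of n)"
proof -
  let ?m = "n + k"
  have "hook_count k (n + k) = (\<Sum>B\<in>beta_sets ?m n. card (hook_starts k B))"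
    using assms by (simp add: hook_count_eq[of _ ?m] sum_hook_ends_eq_sum_hook_starts)
  also have "\<dots> = (\<Sum>B\<in>beta_sets ?m n. card (hook_ends k B) + k)"
    by (intro sum.cong) (auto intro: card_hook_starts)
  also have "\<dots> = hook_count k n + k * card (beta_sets ?m n)"
    using assms by (simp add: hook_count_eq[of _ ?m] sum.distrib)
  also have "card (beta_sets ?m n) = card (partitions_of n)"
    using bij_betw_same_card[OF bij_betw_beta_set[of n ?m]] by simp
  finally show ?thesis .
qed

section \<open>Hook power sums grouped by hook length\<close>

lemma hook_power_sum_eq:
  "hook_power_sum \<alpha> n = (\<Sum>k=1..n. of_nat (hook_count k n) * of_nat k powr \<alpha>)"
proof -
  have "hook_length l v \<in> {1..n}" if "l \<in> partitions_of n" "v \<in> boxes l" for l v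
  proof -
    \<comment> \<open>A hook longer than n would be counted by a \<open>hook_count\<close> that
      vanishes.\<close>
    have "\<not> n < hook_length l v"
    proof
      assume "n < hook_length l v"
      then have "card {u \<in> boxes l. hook_length l u = hook_length l v} = 0"
        using hook_count_eq_0[of n "hook_length l v"] that finite_partitions_of
        by (auto simp: hook_count_def)
      then have "{u \<in> boxes l. hook_length l u = hook_length l v} = {}"
        using finite_boxes[of l] by simp
      then show False using that by blast
    qed
    then show ?thesis by (auto simp: hook_length_def split: prod.splits)
  qed
  then have "(\<Sum>v\<in>boxes l. of_nat (hook_length l v) powr \<alpha>)
      = (\<Sum>k=1..n. of_nat (card {v \<in> boxes l. hook_length l v = k}) * of_nat k powr \<alpha>)"
    if "l \<in> partitions_of n" for l
    using that
    by (subst sum.group[of _ "{1..n}" "hook_length l", symmetric]) (auto simp: finite_boxes)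
  then have "hook_power_sum \<alpha> n = (\<Sum>l\<in>partitions_of n. \<Sum>k=1..n.
      of_nat (card {v \<in> boxes l. hook_length l v = k}) * of_nat k powr \<alpha>)"
    by (simp add: hook_power_sum_def)
  also have "\<dots> = (\<Sum>k=1..n. of_nat (hook_count k n) * of_nat k powr \<alpha>)"
    by (subst sum.swap) (simp add: hook_count_def sum_distrib_right)
  finally show ?thesis .
qed

section \<open>Euler's product for the generating function of partitions\<close>

definition bounded_partitions :: "nat \<Rightarrow> nat \<Rightarrow> nat list set" where
  "bounded_partitions M n = {l \<in> partitions_of n. \<forall>a\<in>set l. a \<le> M}"

definition bounded_partition_fps :: "nat \<Rightarrow> 'a::semiring_1 fps" where
  "bounded_partition_fps M = Abs_fps (\<lambda>n. of_nat (card (bounded_partitions M n)))"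

definition partition_fps :: "'a::semiring_1 fps" where
  "partition_fps = Abs_fps (\<lambda>n. of_nat (card (partitions_of n)))"

lemma finite_bounded_partitions: "finite (bounded_partitions M n)"
  by (simp add: bounded_partitions_def finite_partitions_of)

lemma bounded_partitions_0: "bounded_partitions 0 n = (if n = 0 then {[]} else {})"
proof -
  have "l = []" if "l \<in> bounded_partitions 0 n" for l
    using that by (cases l) (auto simp: bounded_partitions_def partitions_of_def)
  moreover have "[] \<in> bounded_partitions 0 n \<longleftrightarrow> n = 0"
    by (auto simp: bounded_partitions_def partitions_of_def)
  ultimately show ?thesis by auto
qed

text \<open>A part equal to \<open>Suc M\<close> can be taken to stand first, since lists are
  decreasing; the remaining list may contain \<open>Suc M\<close> again, so the bound stays the same
  there.\<close>

lemma bounded_partitions_Suc: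
  "bounded_partitions (Suc M) n = bounded_partitions M n \<union>
     (if Suc M \<le> n then Cons (Suc M) ` bounded_partitions (Suc M) (n - Suc M) else {})"
proof (intro equalityI subsetI)
  fix l assume l: "l \<in> bounded_partitions (Suc M) n"
  show "l \<in> bounded_partitions M n \<union>
     (if Suc M \<le> n then Cons (Suc M) ` bounded_partitions (Suc M) (n - Suc M) else {})"
  proof (cases l)
    case Nil
    then show ?thesis using l by (auto simp: bounded_partitions_def)
  next
    case (Cons a r)
    show ?thesis
    proof (cases "a = Suc M")
      case True
      then show ?thesis using l Cons
        by (auto simp: bounded_partitions_def partitions_of_iff is_partition_Cons)
    next
      case False
      then show ?thesis using l Cons
        by (fastforce simp: bounded_partitions_def partitions_of_iff is_partition_Cons)
    qed
  qed
qed (auto simp: bounded_partitions_def partitions_of_iff is_partition_Cons split: if_splits)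

lemma bounded_partition_fps_Suc:
  "bounded_partition_fps (Suc M) * (1 - fps_X ^ Suc M)
     = (bounded_partition_fps M :: 'a::comm_ring_1 fps)"
proof (rule fps_ext)
  fix n
  have "bounded_partitions M n \<inter> Cons (Suc M) ` bounded_partitions (Suc M) (n - Suc M) = {}"
    by (auto simp: bounded_partitions_def)
  then have "card (bounded_partitions (Suc M) n) = card (bounded_partitions M n) +
      (if Suc M \<le> n then card (bounded_partitions (Suc M) (n - Suc M)) else 0)"
    by (subst bounded_partitions_Suc)
      (auto simp: card_Un_disjoint finite_bounded_partitions card_image)
  then show "fps_nth (bounded_partition_fps (Suc M) * (1 - fps_X ^ Suc M)) n
      = (fps_nth (bounded_partition_fps M) n :: 'a)"
    by (simp add: bounded_partition_fps_def right_diff_distrib fps_X_power_mult_right_nth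
        del: power_Suc)
qed

lemma prod_geometric_fps:
  "(\<Prod>i<M. 1 / (1 - fps_X ^ Suc i)) = (bounded_partition_fps M :: 'a::field fps)"
proof (induction M)
  case 0
  show ?case
    by (rule fps_ext) (simp add: bounded_partition_fps_def bounded_partitions_0)
next
  case (Suc M)
  have nz: "fps_nth (1 - fps_X ^ Suc M :: 'a fps) 0 \<noteq> 0" by simp
  have "(\<Prod>i<Suc M. 1 / (1 - fps_X ^ Suc i))
      = bounded_partition_fps M * inverse (1 - fps_X ^ Suc M :: 'a fps)"
    using Suc nz by (simp add: fps_divide_unit del: power_Suc)
  also have "\<dots> = bounded_partition_fps (Suc M)
      * ((1 - fps_X ^ Suc M) * inverse (1 - fps_X ^ Suc M))"
    by (subst bounded_partition_fps_Suc[symmetric]) (simp only: mult.assoc)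
  also have "\<dots> = bounded_partition_fps (Suc M)"
    using inverse_mult_eq_1'[OF nz] by simp
  finally show ?case .
qed

text \<open>Parts of a partition of n are at most n, so coefficient n of the partial products is
  constant as soon as all factors up to exponent n are present.\<close>

lemma has_prod_geometric_fps:
  "(\<lambda>i. 1 / (1 - fps_X ^ Suc i)) has_prod (partition_fps :: 'a::field fps)"
proof -
  have eq: "fps_nth (bounded_partition_fps M) n = (fps_nth partition_fps n :: 'a)" if "n \<le> M"
    for M n
  proof -
    have "a \<le> M" if "l \<in> partitions_of n" "a \<in> set l" for l a
      using that member_le_sum_list[of a l] \<open>n \<le> M\<close> by (auto simp: partitions_of_def)
    then have "bounded_partitions M n = partitions_of n" by (auto simp: bounded_partitions_def)
    then show ?thesis by (simp add: bounded_partition_fps_def partition_fps_def)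
  qed
  have "(\<lambda>M. \<Prod>i\<le>M. 1 / (1 - fps_X ^ Suc i)) \<longlonglongrightarrow> (partition_fps :: 'a fps)"
  proof (rule tendsto_fpsI)
    fix n
    show "\<forall>\<^sub>F M in sequentially. fps_nth (\<Prod>i\<le>M. 1 / (1 - fps_X ^ Suc i)) n
        = (fps_nth partition_fps n :: 'a)"
      using eventually_ge_at_top[of n]
      by eventually_elim
        (simp add: prod_geometric_fps eq lessThan_Suc_atMost[symmetric] del: power_Suc)
  qed
  \<comment> \<open>\<open>raw_has_prod\<close> demands a nonzero limit; the constant coefficient
    witnesses this.\<close>
  moreover have "fps_nth (partition_fps :: 'a fps) 0 = 1"
    using eq[of 0 0] by (simp add: bounded_partition_fps_def bounded_partitions_0)
  then have "(partition_fps :: 'a fps) \<noteq> 0" by auto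
  ultimately show ?thesis by (simp add: has_prod_def raw_has_prod_def)
qed

section \<open>Summation of formal power series and the final identity\<close>

lemma sums_fpsI:
  fixes f :: "nat \<Rightarrow> 'a::ab_group_add fps"
  assumes "\<And>n k. n \<le> k \<Longrightarrow> fps_nth (f k) n = 0"
    and "\<And>n. fps_nth S n = (\<Sum>k<n. fps_nth (f k) n)"
  shows "f sums S"
  unfolding sums_def
proof (rule tendsto_fpsI)
  fix n
  show "\<forall>\<^sub>F N in sequentially. fps_nth (\<Sum>k<N. f k) n = fps_nth S n"
    using eventually_ge_at_top[of n]
  proof eventually_elim
    case (elim N)
    then show ?case
      by (simp add: assms(2) fps_sum_nth)
        (rule sum.mono_neutral_right, use elim assms(1) in auto)
  qed
qed

text \<open>This is \<open>hook_count_rec\<close> in generating functions: H = X^k (H + k P), where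
  the coefficients below k vanish by \<open>hook_count_eq_0\<close>.\<close>

lemma hook_count_fps:
  assumes "1 \<le> k"
  defines "H \<equiv> Abs_fps (\<lambda>n. of_nat (hook_count k n)) :: 'a::comm_ring_1 fps"
  shows "H * (1 - fps_X ^ k) = partition_fps * (fps_X ^ k * of_nat k)"
proof -
  have "H = fps_X ^ k * (H + of_nat k * partition_fps)"
  proof (rule fps_ext)
    fix n
    show "fps_nth H n = fps_nth (fps_X ^ k * (H + of_nat k * partition_fps)) n"
    proof (cases "n < k")
      case True
      then show ?thesis by (simp add: H_def hook_count_eq_0 fps_X_power_mult_nth)
    next
      case False
      then obtain m where "n = m + k" by (metis add.commute le_Suc_ex not_less)
      then show ?thesis using assms(1)
        by (simp add: H_def hook_count_rec fps_X_power_mult_nth partition_fps_def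
            fps_of_nat[symmetric])
    qed
  qed
  then show ?thesis by (simp add: algebra_simps)
qed

theorem theorem6p2:
  fixes \<alpha> :: complex
  defines "A \<equiv> \<lambda>n. fps_X ^ n * fps_const (hook_power_sum \<alpha> n)"
    and "P \<equiv> \<lambda>m. 1 / (1 - fps_X ^ m) :: complex fps"
    and "B \<equiv> \<lambda>k. fps_X ^ k * fps_const (of_nat k powr (\<alpha> + 1)) / (1 - fps_X ^ k)"
  shows "summable (\<lambda>n. A (Suc n))
    \<and> convergent_prod (\<lambda>m. P (Suc m))
    \<and> summable (\<lambda>k. B (Suc k))
    \<and> (\<Sum>n. A (Suc n)) = (\<Prod>m. P (Suc m)) * (\<Sum>k. B (Suc k))"
proof -
  let ?P = "partition_fps :: complex fps"
  \<comment> \<open>The sum stops at k < n because \<open>B (Suc k)\<close> is divisible by X^(k +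
    1).\<close>
  define S where "S = Abs_fps (\<lambda>n. \<Sum>k<n. fps_nth (B (Suc k)) n)"
  have unit: "fps_nth (1 - fps_X ^ Suc k :: complex fps) 0 \<noteq> 0" for k by simp
  have B_eq: "B (Suc k) = fps_X ^ Suc k
      * (fps_const (of_nat (Suc k) powr (\<alpha> + 1)) * inverse (1 - fps_X ^ Suc k))" for k
    unfolding B_def using unit[of k] by (simp add: fps_divide_unit mult.assoc del: power_Suc)
  have B_nth: "fps_nth (B (Suc k)) n = 0" if "n \<le> k" for n k
    using that unfolding B_eq by (simp add: fps_X_power_mult_nth del: power_Suc)
  have PB: "?P * B (Suc k) = fps_const (of_nat (Suc k) powr \<alpha>)
      * Abs_fps (\<lambda>n. of_nat (hook_count (Suc k) n))" (is "_ = ?c * ?H") for k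
  proof -
    have inv: "inverse (1 - fps_X ^ Suc k) * (1 - fps_X ^ Suc k :: complex fps) = 1"
      using unit by (rule inverse_mult_eq_1)
    have c: "fps_const (of_nat (Suc k) powr (\<alpha> + 1)) = ?c * of_nat (Suc k)"
      by (simp add: powr_add fps_of_nat[symmetric] del: of_nat_Suc)
    \<comment> \<open>The claim is proved after multiplication by 1 - X^(k + 1), which clears the
      denominator and is cancelled at the end.\<close>
    have "?P * B (Suc k) * (1 - fps_X ^ Suc k) = ?P * (fps_X ^ Suc k * (?c * of_nat (Suc k)))
        * (inverse (1 - fps_X ^ Suc k) * (1 - fps_X ^ Suc k))"
      unfolding B_eq c by (simp only: ac_simps)
    also have "\<dots> = ?c * (?P * (fps_X ^ Suc k * of_nat (Suc k)))"
      unfolding inv by (simp only: mult_1_right mult_1_left ac_simps)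
    also have "\<dots> = ?c * ?H * (1 - fps_X ^ Suc k)"
      using hook_count_fps[of "Suc k", where ?'a = complex] by (simp add: mult.assoc del: power_Suc)
    finally show ?thesis using unit[of k] by (metis mult_right_cancel fps_zero_nth)
  qed
  have B: "(\<lambda>k. B (Suc k)) sums S"
    by (rule sums_fpsI) (simp_all add: B_nth S_def)
  have "fps_nth (?P * S) n = hook_power_sum \<alpha> n" for n
  proof -
    have "fps_nth (?P * S) n
        = (\<Sum>i=0..n. \<Sum>k<n - i. fps_nth ?P i * fps_nth (B (Suc k)) (n - i))"
      by (simp add: fps_mult_nth S_def sum_distrib_left)
    \<comment> \<open>The added terms vanish by \<open>B_nth\<close>; with an inner range
      independent of i the two sums can be swapped.\<close>
    also have "\<dots> = (\<Sum>i=0..n. \<Sum>k<n. fps_nth ?P i * fps_nth (B (Suc k)) (n - i))"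
      by (intro sum.cong refl sum.mono_neutral_left) (auto simp: B_nth)
    also have "\<dots> = (\<Sum>k<n. fps_nth (?P * B (Suc k)) n)"
      by (subst sum.swap) (simp add: fps_mult_nth)
    also have "\<dots> = (\<Sum>k<n. of_nat (hook_count (Suc k) n) * of_nat (Suc k) powr \<alpha>)"
      by (simp add: PB mult.commute)
    also have "\<dots> = hook_power_sum \<alpha> n"
      unfolding hook_power_sum_eq
      by (rule sum.reindex_bij_witness[where i = "\<lambda>k. k - 1" and j = Suc]) auto
    finally show ?thesis .
  qed
  \<comment> \<open>The guard 0 < n excludes n = 0, where the truncated n - 1 would wrongly match k
    = 0.\<close>
  moreover have A_nth: "fps_nth (A (Suc k)) n
      = (if k = n - 1 \<and> 0 < n then hook_power_sum \<alpha> n else 0)"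
    for k n
    unfolding A_def by (auto simp: fps_X_power_mult_nth simp del: power_Suc)
  \<comment> \<open>For n = 0 the right-hand sum is empty and
    \<open>hook_power_sum \<alpha> 0\<close> is 0, so starting the series at exponent 1 loses
    nothing.\<close>
  moreover have "hook_power_sum \<alpha> n = (\<Sum>k<n. fps_nth (A (Suc k)) n)" for n
    by (cases n) (simp_all add: A_nth hook_power_sum_eq[of _ 0])
  ultimately have A: "(\<lambda>n. A (Suc n)) sums (?P * S)"
    by (intro sums_fpsI) auto
  have P: "(\<lambda>m. P (Suc m)) has_prod ?P"
    unfolding P_def by (rule has_prod_geometric_fps)
  then have "convergent_prod (\<lambda>m. P (Suc m))"
    unfolding P_def has_prod_def convergent_prod_def by blast
  then show ?thesis
    using sums_summable[OF A] sums_summable[OF B] sums_unique[OF A] sums_unique[OF B]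
      has_prod_unique[OF P] by simp
qed

end
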